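(* Let $K\in\mathcal{C}(I,\{c_k\}_k,\{n_k\}_k,\{a_k\}_k)$ be a Cantor-like set, where $c_*=\inf_k c_k>0$. Then $$\dim_A K=\lim_{m\to\infty}\left(\sup_{k\ge1}\frac{\log(n_k\cdots n_{k+m})}{-\log(c_k\cdots c_{k+m})}\right).$$
   Context: Assouad dimension: for a metric space $X$ and $0<r<R$, $N_{r,R}(X)$ is the smallest number $N$ such that every ball of radius $R$ in $X$ can be covered by $N$ balls of radius $r$. Then $$\dim_A(X)=\inf\{\alpha\ge 0:\ \exists\, b,c>0 \text{ such that } N_{r,R}(X)\le c(R/r)^\alpha \text{ for all } 0<r<R<b\}.$$ A subset of $\mathbb{R}^d$ is regarded as a metric space with the Euclidean metric. $|A|$ denotes the diameter of a set $A$, and $\mathrm{int}(A)$ its interior. Cantor-like sets: let $\{a_k\}_{k\ge1}$ be positive numbers with $\sum_k a_k<\infty$, and let $c_k\in(0,1)$ and $n_k\in\mathbb{N}\cap[2,\infty)$ for all $k\ge1$, with $c_*=\inf_kc_k>0$. Let $D_k=\{i_1\cdots i_k:1\le i_j\le n_j,\ j\le k\}$ for $k\ge1$, and $D_0=\{\emptyset\}$ (the empty word). Let $I\subset\mathbb{R}^d$ be a compact set with $\mathrm{int}(I)\ne\varnothing$, and put $I_\emptyset=I$. Suppose that for each $k\ge1$ and each $i_1\cdots i_{k-1}\in D_{k-1}$ there are subsets $I_{i_1\cdots i_{k-1}1},\dots,I_{i_1\cdots i_{k-1}n_k}$ of $I_{i_1\cdots i_{k-1}}$, with pairwise disjoint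 interiors, each geometrically similar to $I_{i_1\cdots i_{k-1}}$ (i.e. its image under a similarity of $\mathbb{R}^d$, with positive ratio), such that $$c_k(1-a_k)\le\frac{|I_{i_1\cdots i_{k-1}j}|}{|I_{i_1\cdots i_{k-1}}|}\le c_k(1+a_k),\qquad j=1,\dots,n_k.$$ The set $K=\bigcap_{k\ge1}\bigcup_{i_1\cdots i_k\in D_k}I_{i_1\cdots i_k}$ is called a Cantor-like set, and $\mathcal{C}(I,\{c_k\}_k,\{n_k\}_k,\{a_k\}_k)$ denotes the collection of all such sets. *)

theory Defs
  imports "HOL-Analysis.Analysis"
begin

text \<open>
  A set \<open>X\<close> is regarded as a metric space with the induced metric: the balls of \<open>X\<close> are the sets
  \<open>X \<inter> ball x r\<close> with centre \<open>x \<in> X\<close>.  The value is \<open>\<infinity>\<close> if no finite number of balls suffices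
  uniformly in the centre.
\<close>

definition covering_number :: "real \<Rightarrow> real \<Rightarrow> 'a::metric_space set \<Rightarrow> enat" where
  "covering_number r R X =
     Inf {enat N |N. \<forall>x\<in>X. \<exists>C\<subseteq>X. finite C \<and> card C \<le> N \<and>
                       X \<inter> ball x R \<subseteq> (\<Union>y\<in>C. X \<inter> ball y r)}"

text \<open>The infimum is taken in \<^typ>\<open>ereal\<close>, so that it is \<open>\<infinity>\<close> when there is no admissible exponent.\<close>

definition assouad_dim :: "'a::metric_space set \<Rightarrow> ereal" where
  "assouad_dim X =
     (INF \<alpha> \<in> {\<alpha>. 0 \<le> \<alpha> \<and>
                  (\<exists>b c. 0 < b \<and> 0 < c \<and>
                    (\<forall>r R. 0 < r \<and> r < R \<and> R < b \<longrightarrow>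
                       ereal_of_enat (covering_number r R X) \<le> ereal (c * (R / r) powr \<alpha>)))}.
        ereal \<alpha>)"

definition similarity :: "real \<Rightarrow> ('a::metric_space \<Rightarrow> 'a) \<Rightarrow> bool" where
  "similarity \<rho> f \<longleftrightarrow> 0 < \<rho> \<and> (\<forall>x y. dist (f x) (f y) = \<rho> * dist x y)"

definition geometrically_similar :: "'a::metric_space set \<Rightarrow> 'a set \<Rightarrow> bool" where
  "geometrically_similar A B \<longleftrightarrow> (\<exists>\<rho> f. similarity \<rho> f \<and> A = f ` B)"

text \<open>
  All sequences are indexed by \<open>k \<ge> 1\<close>; their value at \<open>0\<close> is never used.  Lists are indexed from
  \<open>0\<close>, so the letter \<open>i\<^sub>j\<close> of a word \<open>w\<close> is \<open>w ! (j - 1)\<close>.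
\<close>

definition cantor_words :: "(nat \<Rightarrow> nat) \<Rightarrow> nat \<Rightarrow> nat list set" where
  "cantor_words n k = {w. length w = k \<and> (\<forall>j\<in>{1..k}. w ! (j - 1) \<in> {1..n j})}"

definition cantor_like_sets ::
    "'a::euclidean_space set \<Rightarrow> (nat \<Rightarrow> real) \<Rightarrow> (nat \<Rightarrow> nat) \<Rightarrow> (nat \<Rightarrow> real) \<Rightarrow> 'a set set" where
  "cantor_like_sets I c n a =
     {K. \<exists>J :: nat list \<Rightarrow> 'a set.
           J [] = I \<and>
           (\<forall>k\<ge>1. \<forall>w\<in>cantor_words n (k - 1).
              (\<forall>j\<in>{1..n k}.
                 J (w @ [j]) \<subseteq> J w \<and>
                 geometrically_similar (J (w @ [j])) (J w) \<and>
                 c k * (1 - a k) \<le> diameter (J (w @ [j])) / diameter (J w) \<and>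
                 diameter (J (w @ [j])) / diameter (J w) \<le> c k * (1 + a k)) \<and>
              disjoint_family_on (\<lambda>j. interior (J (w @ [j]))) {1..n k}) \<and>
           K = (\<Inter>k\<in>{1..}. \<Union>w\<in>cantor_words n k. J w)}"

end

theory Submission
  imports Defs
begin

text \<open>
  Write \<open>P\<^sub>k = c\<^sub>1\<cdots>c\<^sub>k\<close>, \<open>Q\<^sub>k = n\<^sub>1\<cdots>n\<^sub>k\<close>, \<open>u = ln Q\<close>, \<open>v = - ln P\<close>. By summability of the \<open>a\<^sub>k\<close>, every basic set
  of level \<open>k\<close> has diameter comparable to \<open>P\<^sub>k\<close>, uniformly in \<open>k\<close>, and it contains a ball of comparable
  radius; these balls are disjoint, so by volume a ball of radius \<open>P\<^sub>k\<close> meets boundedly many basic sets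
  of level \<open>k\<close>. Covering a ball of radius \<open>P\<^sub>k\<close> by balls of radius \<open>P\<^sub>l\<close> therefore takes \<open>Q\<^sub>l / Q\<^sub>k\<close> balls up
  to a constant, and \<open>\<alpha> \<ge> 0\<close> is an admissible exponent iff \<open>u\<^sub>l - u\<^sub>k \<le> \<alpha> (v\<^sub>l - v\<^sub>k) + E\<close> for some \<open>E\<close> and
  all \<open>k \<le> l\<close>. Cutting \<open>{k..l}\<close> into blocks of length \<open>m + 1\<close> shows that this holds for every \<open>\<alpha>\<close> above
  the supremum of the block slopes; conversely, \<open>v\<close> grows at least linearly (again by volume), so the
  error \<open>E\<close> disappears from the slopes as \<open>m \<rightarrow> \<infinity>\<close>.
\<close>

section \<open>Similarities, packings and covering numbers\<close>

text \<open>The map \<open>f - f 0\<close> scales distances and fixes 0, hence is linear; being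
  injective in finite dimension, it is onto.\<close>

lemma similarity_surj:
  fixes f :: "'a::euclidean_space \<Rightarrow> 'a"
  assumes "similarity \<rho> f"
  shows "surj f"
proof -
  define g where "g = (\<lambda>x. f x - f 0)"
  have \<rho>: "\<rho> > 0" and f: "\<And>x y. dist (f x) (f y) = \<rho> * dist x y"
    using assms by (auto simp: similarity_def)
  have g: "dist (g x) (g y) = \<rho> * dist x y" for x y
    using f[of x y] by (simp add: g_def dist_norm)
  have "linear g"
    by (rule scaling_linear[where c = \<rho>]) (use g in \<open>auto simp: g_def\<close>)
  moreover have "inj g"
    by (rule injI) (metis g \<rho> dist_eq_0_iff mult_eq_0_iff less_irrefl)
  ultimately have "surj g"
    by (simp add: linear_injective_imp_surjective)
  show ?thesis
  proof (rule surjI[where g = f and f = "\<lambda>y. inv g (y - f 0)"])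
    fix y
    have "g (inv g (y - f 0)) = y - f 0"
      using \<open>surj g\<close> by (rule surj_f_inv_f)
    then show "f (inv g (y - f 0)) = y"
      by (simp add: g_def)
  qed
qed

text \<open>Lets inscribed balls be passed from a basic set to its children; surjectivity provides a
  preimage for each point of the target ball.\<close>

lemma similarity_ball:
  fixes f :: "'a::euclidean_space \<Rightarrow> 'a"
  assumes "similarity \<rho> f"
  shows "ball (f z) (\<rho> * s) \<subseteq> f ` ball z s"
proof
  fix y assume y: "y \<in> ball (f z) (\<rho> * s)"
  obtain x where x: "y = f x"
    using similarity_surj[OF assms] by (meson surjD)
  then show "y \<in> f ` ball z s"
    using y assms by (auto simp: similarity_def)
qed

lemma similarity_compact:
  fixes f :: "'a::metric_space \<Rightarrow> 'a"
  assumes "similarity \<rho> f" "compact S"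
  shows "compact (f ` S)"
proof (rule compact_continuous_image[OF _ \<open>compact S\<close>])
  have "\<rho>-lipschitz_on S f"
    using assms by (auto simp: similarity_def intro!: lipschitz_onI)
  then show "continuous_on S f"
    by (rule lipschitz_on_continuous_on)
qed

lemma similarity_diameter:
  fixes f :: "'a::euclidean_space \<Rightarrow> 'a"
  assumes sim: "similarity \<rho> f" and "compact S" "S \<noteq> {}"
  shows "diameter (f ` S) = \<rho> * diameter S"
proof (rule antisym)
  have \<rho>: "\<rho> > 0" and f: "\<And>x y. dist (f x) (f y) = \<rho> * dist x y"
    using sim by (auto simp: similarity_def)
  have bd: "bounded S" "bounded (f ` S)"
    using assms similarity_compact compact_imp_bounded by auto
  have "dist x y \<le> diameter S" if "x \<in> S" "y \<in> S" for x y
    using bd that diameter_bounded_bound by blast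
  then show "diameter (f ` S) \<le> \<rho> * diameter S"
    using \<rho> f \<open>S \<noteq> {}\<close> by (intro diameter_le) (auto simp flip: dist_norm)
  obtain x y where "x \<in> S" "y \<in> S" "dist x y = diameter S"
    using diameter_compact_attained assms by blast
  then show "\<rho> * diameter S \<le> diameter (f ` S)"
    using diameter_bounded_bound[of "f ` S" "f x" "f y"] f bd by simp
qed

text \<open>Lebesgue measure is additive on the disjoint balls and monotone; the volume of the unit
  ball cancels.\<close>

lemma card_disjoint_balls:
  fixes p :: "'i \<Rightarrow> 'a::euclidean_space"
  assumes "finite S" "s > 0" "T \<ge> 0"
    and disj: "disjoint_family_on (\<lambda>i. ball (p i) s) S"
    and sub: "\<And>i. i \<in> S \<Longrightarrow> ball (p i) s \<subseteq> ball x T"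
  shows "real (card S) * s ^ DIM('a) \<le> T ^ DIM('a)"
proof -
  let ?V = "unit_ball_vol (real DIM('a))"
  have fm: "ball y r \<in> fmeasurable lborel" for y :: 'a and r
    using emeasure_lborel_ball_finite[of y r] by (intro fmeasurableI) (auto simp: infinity_ennreal_def)
  have "real (card S) * (?V * s ^ DIM('a)) = (\<Sum>i\<in>S. measure lborel (ball (p i) s))"
    using \<open>s > 0\<close> by (simp add: content_ball)
  also have "\<dots> = measure lborel (\<Union>i\<in>S. ball (p i) s)"
    by (rule measure_UNION'[symmetric])
       (use \<open>finite S\<close> disj fm in \<open>auto simp: disjoint_family_on_def pairwise_def disjnt_def\<close>)
  also have "\<dots> \<le> measure lborel (ball x T)"
    using sub \<open>finite S\<close> fm by (intro measure_mono_fmeasurable) auto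
  also have "\<dots> = ?V * T ^ DIM('a)"
    using \<open>T \<ge> 0\<close> by (simp add: content_ball)
  finally have "?V * (real (card S) * s ^ DIM('a)) \<le> ?V * T ^ DIM('a)"
    by (simp add: mult_ac)
  then show ?thesis
    by (simp add: mult_le_cancel_left_pos)
qed

section \<open>Covering numbers\<close>

lemma covering_number_le:
  assumes "\<And>x. x \<in> X \<Longrightarrow> \<exists>C\<subseteq>X. finite C \<and> real (card C) \<le> B \<and>
             X \<inter> ball x R \<subseteq> (\<Union>y\<in>C. X \<inter> ball y r)" and "0 \<le> B"
  shows "ereal_of_enat (covering_number r R X) \<le> ereal B"
proof -
  \<comment> \<open>The competitors are natural numbers, so the real bound may be rounded
    down.\<close>
  have "covering_number r R X \<le> enat (nat \<lfloor>B\<rfloor>)"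
    unfolding covering_number_def
  proof (rule Inf_lower, rule CollectI, rule exI, rule conjI, rule refl, rule ballI)
    fix x assume "x \<in> X"
    then obtain C where C: "C \<subseteq> X" "finite C" "real (card C) \<le> B"
      "X \<inter> ball x R \<subseteq> (\<Union>y\<in>C. X \<inter> ball y r)"
      using assms(1) by blast
    then show "\<exists>C\<subseteq>X. finite C \<and> card C \<le> nat \<lfloor>B\<rfloor> \<and> X \<inter> ball x R \<subseteq> (\<Union>y\<in>C. X \<inter> ball y r)"
      using le_nat_floor by blast
  qed
  then have "ereal_of_enat (covering_number r R X) \<le> ereal (real (nat \<lfloor>B\<rfloor>))"
    by (metis ereal_of_enat_le_iff ereal_of_enat_simps(1))
  also have "\<dots> \<le> ereal B"
    using \<open>0 \<le> B\<close> by simp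
  finally show ?thesis .
qed

lemma covering_number_leD:
  assumes "ereal_of_enat (covering_number r R X) \<le> ereal B" and "x \<in> X"
  obtains C where "C \<subseteq> X" "finite C" "real (card C) \<le> B" "X \<inter> ball x R \<subseteq> (\<Union>y\<in>C. X \<inter> ball y r)"
proof -
  let ?S = "{enat N |N. \<forall>x\<in>X. \<exists>C\<subseteq>X. finite C \<and> card C \<le> N \<and>
                       X \<inter> ball x R \<subseteq> (\<Union>y\<in>C. X \<inter> ball y r)}"
  have eq: "covering_number r R X = Inf ?S"
    by (simp only: covering_number_def)
  \<comment> \<open>Without any competitor the infimum in \<open>enat\<close> would be
    \<open>\<infinity>\<close>, against the real bound; with one, it is attained.\<close>
  have "?S \<noteq> {}"
  proof
    assume "?S = {}"
    then have "covering_number r R X = \<infinity>"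
      by (simp only: eq) (simp add: Inf_enat_def)
    with assms(1) show False by simp
  qed
  then have "Inf ?S \<in> ?S"
    unfolding Inf_enat_def by (metis (mono_tags, lifting) LeastI_ex ex_in_conv)
  then obtain N where N: "covering_number r R X = enat N"
    "\<forall>x\<in>X. \<exists>C\<subseteq>X. finite C \<and> card C \<le> N \<and> X \<inter> ball x R \<subseteq> (\<Union>y\<in>C. X \<inter> ball y r)"
    unfolding eq by blast
  then obtain C where C: "C \<subseteq> X" "finite C" "card C \<le> N" "X \<inter> ball x R \<subseteq> (\<Union>y\<in>C. X \<inter> ball y r)"
    using \<open>x \<in> X\<close> by blast
  have "real N \<le> B"
    using assms(1) N(1) by simp
  with C(3) have "real (card C) \<le> B" by linarith
  with C show thesis using that by blast
qed

section \<open>Slopes of increments\<close>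

text \<open>Once \<open>a k < 1 / 2\<close>, each factor \<open>1 - a k\<close> is at least
  \<open>exp (- 2 * a k)\<close>, so summability keeps the product of the factors away from
  0.\<close>

lemma positive_sequence_bounded_below:
  fixes l a :: "nat \<Rightarrow> real"
  assumes pos: "\<And>k. l k > 0" and a: "\<And>k. a k \<ge> 0" "summable a"
    and step: "\<And>k. (1 - a k) * l k \<le> l (Suc k)"
  obtains L where "L > 0" "\<And>k. L \<le> l k"
proof -
  have "a \<longlonglongrightarrow> 0"
    using \<open>summable a\<close> by (rule summable_LIMSEQ_zero)
  then have "\<forall>\<^sub>F k in sequentially. a k < 1 / 2"
    by (rule order_tendstoD) auto
  then obtain k0 where k0: "\<And>k. k \<ge> k0 \<Longrightarrow> a k < 1 / 2"
    by (auto simp: eventually_sequentially)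
  have tail: "l k0 * exp (- 2 * (\<Sum>j\<in>{k0..<k}. a j)) \<le> l k" if "k \<ge> k0" for k
    using that
  proof (induction k rule: dec_induct)
    case base
    then show ?case by simp
  next
    case (step k)
    \<comment> \<open>For \<open>0 \<le> t \<le> 1 / 2\<close>, the bound
      \<open>exp (- 2 * t) \<le> 1 - t\<close> follows from
      \<open>1 + 2 * t \<le> exp (2 * t)\<close> and
      \<open>1 \<le> (1 - t) * (1 + 2 * t)\<close>.\<close>
    have "exp (- 2 * a k) * (1 + 2 * a k) \<le> exp (- 2 * a k) * exp (2 * a k)"
      by (intro mult_left_mono exp_ge_add_one_self) auto
    then have "exp (- 2 * a k) * (1 + 2 * a k) \<le> 1"
      by (simp flip: exp_add)
    moreover have "1 \<le> (1 - a k) * (1 + 2 * a k)"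
      using k0[OF step(1)] a(1)[of k] mult_nonneg_nonneg[of "a k" "1 - 2 * a k"]
      by (simp add: algebra_simps)
    ultimately have "exp (- 2 * a k) * (1 + 2 * a k) \<le> (1 - a k) * (1 + 2 * a k)"
      by linarith
    then have e: "exp (- 2 * a k) \<le> 1 - a k"
      using a(1)[of k] by (simp add: mult_le_cancel_right)
    have "l k0 * exp (- 2 * (\<Sum>j\<in>{k0..<Suc k}. a j))
        = exp (- 2 * a k) * (l k0 * exp (- 2 * (\<Sum>j\<in>{k0..<k}. a j)))"
      using step(1) by (simp add: algebra_simps exp_diff exp_minus exp_add divide_inverse)
    also have "\<dots> \<le> (1 - a k) * l k"
      using e step.IH pos[of k0] k0[OF step(1)] by (intro mult_mono) auto
    finally show ?case
      using assms(4)[of k] by linarith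
  qed
  \<comment> \<open>Before \<open>k0\<close> the factors \<open>1 - a k\<close> may be nonpositive;
    there the minimum of finitely many positive values serves.\<close>
  define L where "L = Min (insert (l k0 * exp (- 2 * suminf a)) (l ` {..k0}))"
  have "L > 0"
    using pos by (auto simp: L_def)
  moreover have "L \<le> l k" for k
  proof (cases "k \<le> k0")
    case True
    then show ?thesis unfolding L_def by (intro Min_le) auto
  next
    case False
    have "L \<le> l k0 * exp (- 2 * suminf a)"
      unfolding L_def by (intro Min_le) auto
    also have "\<dots> \<le> l k0 * exp (- 2 * (\<Sum>j\<in>{k0..<k}. a j))"
      using sum_le_suminf[OF \<open>summable a\<close>, of "{k0..<k}"] a(1) pos[of k0] by auto
    also have "\<dots> \<le> l k"
      using tail False by auto
    finally show ?thesis .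
  qed
  ultimately show thesis by (rule that)
qed

text \<open>With \<open>u = ln Q\<close> and \<open>v = - ln P\<close> this is the logarithmic form
  of \<open>Q l / Q k \<le> exp E * (P k / P l) powr \<alpha>\<close>; the slack \<open>E\<close>
  absorbs multiplicative constants.\<close>

definition dominated_increments :: "(nat \<Rightarrow> real) \<Rightarrow> (nat \<Rightarrow> real) \<Rightarrow> real \<Rightarrow> bool" where
  "dominated_increments u v \<alpha> \<longleftrightarrow> (\<exists>E. \<forall>k l. k \<le> l \<longrightarrow> u l - u k \<le> \<alpha> * (v l - v k) + E)"

text \<open>Full blocks of \<open>m + 1\<close> steps satisfy the estimate without error, so errors
  do not accumulate: only the last, incomplete block costs up to \<open>m * X\<close>.\<close>

lemma dominated_incrementsI:
  assumes X: "\<And>k. u (Suc k) - u k \<le> X" and mono: "mono u" "mono v" and "\<alpha> \<ge> 0"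
    and step: "\<And>k. u (k + Suc m) - u k \<le> \<alpha> * (v (k + Suc m) - v k)"
  shows "dominated_increments u v \<alpha>"
  unfolding dominated_increments_def
proof (intro exI allI impI)
  have uX: "u (k + i) - u k \<le> real i * X" for k i
  proof (induction i)
    case (Suc i)
    then show ?case using X[of "k + i"] by (simp add: algebra_simps)
  qed simp
  have "X \<ge> 0"
    using X[of 0] monoD[OF \<open>mono u\<close>, of 0 1] by simp
  have "u (k + i) - u k \<le> \<alpha> * (v (k + i) - v k) + real m * X" for i k
  proof (induction i arbitrary: k rule: less_induct)
    case (less i)
    show ?case
    proof (cases "i \<le> m")
      case True
      then have "real i * X \<le> real m * X"
        using \<open>X \<ge> 0\<close> by (intro mult_right_mono) auto
      moreover have "0 \<le> \<alpha> * (v (k + i) - v k)"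
        using \<open>\<alpha> \<ge> 0\<close> monoD[OF \<open>mono v\<close>, of k "k + i"] by simp
      ultimately show ?thesis
        using uX[of k i] by linarith
    next
      case False
      \<comment> \<open>A full block is split off at the left end, where \<open>step\<close>
        applies.\<close>
      then obtain j where j: "i = Suc m + j"
        by (metis less_eq_Suc_le not_le le_Suc_ex)
      then show ?thesis
        using less.IH[of j "k + Suc m"] step[of k] by (simp add: algebra_simps)
    qed
  qed
  then show "u l - u k \<le> \<alpha> * (v l - v k) + real m * X" if "k \<le> l" for k l
    using le_Suc_ex[OF that] by auto
qed

text \<open>The infimum lies below \<open>?L m\<close> for every \<open>m\<close>, because a bound
  on all slopes of one block length is a dominating exponent; linear growth of \<open>v\<close>
  makes the slack \<open>E\<close> negligible in long blocks.\<close>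

lemma block_slopes_tendsto:
  fixes u v :: "nat \<Rightarrow> real"
  assumes X: "\<And>k. u (Suc k) - u k \<le> X" and u: "\<And>k. u k \<le> u (Suc k)"
    and v: "\<And>k. v k < v (Suc k)" and "\<delta> > 0"
    and lin: "\<And>k m. \<delta> * real m - G \<le> v (k + m) - v k"
  shows "(\<lambda>m. SUP k. ereal ((u (k + Suc m) - u k) / (v (k + Suc m) - v k)))
           \<longlonglongrightarrow> (INF \<alpha> \<in> {\<alpha>. 0 \<le> \<alpha> \<and> dominated_increments u v \<alpha>}. ereal \<alpha>)"
    (is "?L \<longlonglongrightarrow> ?d")
proof (rule order_tendstoI)
  have "mono u" "strict_mono v"
    using u v by (auto simp: mono_iff_le_Suc strict_mono_Suc_iff)
  then have pos: "v (k + Suc m) - v k > 0" "u (k + Suc m) - u k \<ge> 0" for k m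
    by (auto simp: strict_monoD monoD)
  have le: "?d \<le> ?L m" for m
  \<comment> \<open>A \<open>y\<close> strictly above \<open>?L m\<close> is a real exponent unless
    it is infinite and the claim trivial, so finiteness of \<open>?L m\<close> need not be
    known.\<close>
  proof (rule dense_ge)
    fix y assume y: "?L m < y"
    \<comment> \<open>Only exponents \<open>\<ge> 0\<close> compete in the infimum.\<close>
    have "0 \<le> ereal ((u (0 + Suc m) - u 0) / (v (0 + Suc m) - v 0))"
      using pos[where k = 0] by (simp add: less_imp_le)
    also have "\<dots> \<le> ?L m"
      by (rule SUP_upper) simp
    finally have "0 \<le> ?L m" .
    show "?d \<le> y"
    proof (cases y)
      case (real \<alpha>)
      then have "\<alpha> \<ge> 0"
        using order_trans[OF \<open>0 \<le> ?L m\<close> less_imp_le[OF y]] by simp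
      moreover have "u (k + Suc m) - u k \<le> \<alpha> * (v (k + Suc m) - v k)" for k
      proof -
        have "ereal ((u (k + Suc m) - u k) / (v (k + Suc m) - v k)) \<le> ?L m"
          by (rule SUP_upper) simp
        from order_trans[OF this less_imp_le[OF y]]
        have "(u (k + Suc m) - u k) / (v (k + Suc m) - v k) \<le> \<alpha>"
          unfolding real by (simp only: ereal_less_eq)
        then show ?thesis
          using pos(1)[of k m] by (simp only: pos_divide_le_eq)
      qed
      ultimately have "dominated_increments u v \<alpha>"
        using \<open>mono u\<close> \<open>strict_mono v\<close> X
        by (intro dominated_incrementsI) (auto simp: strict_mono_mono)
      with \<open>\<alpha> \<ge> 0\<close> show ?thesis
        unfolding real by (intro INF_lower) auto
    next
      case MInf
      then show ?thesis using y by simp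
    qed auto
  qed
  then show "\<forall>\<^sub>F m in sequentially. y < ?L m" if "y < ?d" for y
    using that less_le_trans by (intro always_eventually) blast
  show "\<forall>\<^sub>F m in sequentially. ?L m < y" if "?d < y" for y
  proof -
    obtain \<alpha> where \<alpha>: "dominated_increments u v \<alpha>" "ereal \<alpha> < y"
      using \<open>?d < y\<close> by (auto simp: INF_less_iff)
    \<comment> \<open>The gap \<open>\<beta> - \<alpha>\<close> is what has to absorb
      \<open>E\<close>.\<close>
    then obtain \<beta> where \<beta>: "\<alpha> < \<beta>" "ereal \<beta> < y"
      using ereal_dense2 by fastforce
    from \<alpha> obtain E where E: "\<And>k l. k \<le> l \<Longrightarrow> u l - u k \<le> \<alpha> * (v l - v k) + E"
      by (auto simp: dominated_increments_def)
    \<comment> \<open>Over more than \<open>m0\<close> steps, \<open>v\<close> increases by at least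
      \<open>E / (\<beta> - \<alpha>)\<close>, uniformly in \<open>k\<close>.\<close>
    obtain m0 where m0: "(E / (\<beta> - \<alpha>) + G) / \<delta> < real m0"
      using reals_Archimedean2 by blast
    have "?L m < y" if "m \<ge> m0" for m
    proof -
      have "(u (k + Suc m) - u k) / (v (k + Suc m) - v k) \<le> \<beta>" for k
      proof -
        have "(E / (\<beta> - \<alpha>) + G) / \<delta> < real (Suc m)"
          using m0 that by linarith
        then have "E / (\<beta> - \<alpha>) \<le> v (k + Suc m) - v k"
          using lin[of "Suc m" k] \<open>\<delta> > 0\<close> by (simp add: pos_divide_less_eq mult.commute)
        then have "E \<le> (v (k + Suc m) - v k) * (\<beta> - \<alpha>)"
          using \<open>\<alpha> < \<beta>\<close> by (simp add: pos_divide_le_eq)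
        with E[of k "k + Suc m"] have "u (k + Suc m) - u k \<le> \<beta> * (v (k + Suc m) - v k)"
          by (simp add: algebra_simps)
        then show ?thesis
          using pos(1)[of k m] by (simp only: pos_divide_le_eq)
      qed
      then have "?L m \<le> ereal \<beta>"
        by (intro SUP_least) simp
      then show ?thesis using \<beta>(2) by (rule le_less_trans)
    qed
    then show ?thesis
      by (auto simp: eventually_sequentially)
  qed
qed

section \<open>Cantor-like constructions\<close>

lemma cantor_words_0 [simp]: "cantor_words n 0 = {[]}"
  by (auto simp: cantor_words_def)

lemma cantor_words_Suc:
  "cantor_words n (Suc k) = (\<lambda>(w, j). w @ [j]) ` (cantor_words n k \<times> {1..n (Suc k)})"
  (is "?L = ?R")
proof
  show "?L \<subseteq> ?R"
  proof
    fix w assume w: "w \<in> ?L"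
    then have len: "length w = Suc k" and letter: "\<And>j. j \<in> {1..Suc k} \<Longrightarrow> w ! (j - 1) \<in> {1..n j}"
      by (auto simp: cantor_words_def)
    from len obtain u j where uj: "w = u @ [j]" "length u = k"
      by (metis length_Suc_conv_rev)
    have "u ! (i - 1) \<in> {1..n i}" if "i \<in> {1..k}" for i
      using letter[of i] that uj by (auto simp: nth_append split: if_splits)
    moreover have "j \<in> {1..n (Suc k)}"
      using letter[of "Suc k"] uj by auto
    ultimately show "w \<in> ?R"
      using uj by (auto simp: cantor_words_def)
  qed
  show "?R \<subseteq> ?L"
    by (auto simp: cantor_words_def nth_append le_Suc_eq)
qed

lemma cantor_words_snoc_iff:
  "w @ [j] \<in> cantor_words n (Suc k) \<longleftrightarrow> w \<in> cantor_words n k \<and> j \<in> {1..n (Suc k)}"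
  by (auto simp: cantor_words_Suc)

lemma cantor_words_SucE:
  assumes "w \<in> cantor_words n (Suc k)"
  obtains u j where "w = u @ [j]" "u \<in> cantor_words n k" "j \<in> {1..n (Suc k)}"
  using assms by (auto simp: cantor_words_Suc)

lemma length_cantor_words: "w \<in> cantor_words n k \<Longrightarrow> length w = k"
  by (simp add: cantor_words_def)

lemma finite_cantor_words [simp, intro]: "finite (cantor_words n k)"
  by (induction k) (auto simp: cantor_words_Suc)

lemma take_cantor_words: "w \<in> cantor_words n l \<Longrightarrow> k \<le> l \<Longrightarrow> take k w \<in> cantor_words n k"
  by (auto simp: cantor_words_def)

text \<open>Each further place multiplies the count by its number of letters, independently of the
  prefix.\<close>

lemma card_cantor_words_extending:
  assumes "w \<in> cantor_words n k" "k \<le> l"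
  shows "card {v \<in> cantor_words n l. take k v = w} = (\<Prod>j\<in>{k<..l}. n j)"
  using \<open>k \<le> l\<close>
proof (induction l rule: dec_induct)
  case base
  have "{v \<in> cantor_words n k. take k v = w} = {w}"
    using assms by (auto simp: length_cantor_words)
  then show ?case by simp
next
  case (step l)
  let ?E = "\<lambda>l. {v \<in> cantor_words n l. take k v = w}"
  have "?E (Suc l) = (\<lambda>(v, j). v @ [j]) ` (?E l \<times> {1..n (Suc l)})"
    using step(1) by (auto simp: cantor_words_Suc length_cantor_words image_iff)
  moreover have "inj_on (\<lambda>(v, j). v @ [j]) (?E l \<times> {1..n (Suc l)})"
    by (auto simp: inj_on_def)
  ultimately have "card (?E (Suc l)) = card (?E l) * n (Suc l)"
    by (simp add: card_image card_cartesian_product)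
  moreover have "{k<..Suc l} = insert (Suc l) {k<..l}"
    using step(1) by auto
  ultimately show ?case
    using step.IH by simp
qed

text \<open>Indexing by \<open>Suc k\<close> restricts the sequences to indices
  \<open>\<ge> 1\<close> and lets inductions over levels start at 0; the positive infimum of
  \<open>c\<close> enters as an explicit lower bound.\<close>

locale cantor_construction =
  fixes J :: "nat list \<Rightarrow> 'a::euclidean_space set" and c :: "nat \<Rightarrow> real"
    and n :: "nat \<Rightarrow> nat" and a :: "nat \<Rightarrow> real"
  assumes a_pos: "\<And>k. a (Suc k) > 0"
    and a_summable: "summable (\<lambda>k. a (Suc k))"
    and c_pos: "\<And>k. 0 < c (Suc k)" and c_less_1: "\<And>k. c (Suc k) < 1"
    and n_ge_2: "\<And>k. n (Suc k) \<ge> 2"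
    and c_bounded_below: "\<exists>\<gamma>>0. \<forall>k. \<gamma> \<le> c (Suc k)"
    and compact_root: "compact (J [])"
    and interior_root: "interior (J []) \<noteq> {}"
    and child_subset: "\<And>k w j. w \<in> cantor_words n k \<Longrightarrow> j \<in> {1..n (Suc k)} \<Longrightarrow> J (w @ [j]) \<subseteq> J w"
    and child_similar: "\<And>k w j. w \<in> cantor_words n k \<Longrightarrow> j \<in> {1..n (Suc k)} \<Longrightarrow>
          geometrically_similar (J (w @ [j])) (J w)"
    and child_diameter_ge: "\<And>k w j. w \<in> cantor_words n k \<Longrightarrow> j \<in> {1..n (Suc k)} \<Longrightarrow>
          c (Suc k) * (1 - a (Suc k)) \<le> diameter (J (w @ [j])) / diameter (J w)"
    and child_diameter_le: "\<And>k w j. w \<in> cantor_words n k \<Longrightarrow> j \<in> {1..n (Suc k)} \<Longrightarrow>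
          diameter (J (w @ [j])) / diameter (J w) \<le> c (Suc k) * (1 + a (Suc k))"
    and children_disjoint: "\<And>k w. w \<in> cantor_words n k \<Longrightarrow>
          disjoint_family_on (\<lambda>j. interior (J (w @ [j]))) {1..n (Suc k)}"
begin

section \<open>Products of ratios and branching numbers\<close>

abbreviation D :: "nat \<Rightarrow> nat list set" where "D \<equiv> cantor_words n"

definition K :: "'a set" where "K = (\<Inter>k\<in>{1..}. \<Union>w\<in>D k. J w)"

text \<open>The diameter at level \<open>k\<close> if the root had diameter 1 and all ratios were
  exact.\<close>

definition P :: "nat \<Rightarrow> real" where "P k = (\<Prod>j=1..k. c j)"

definition Q :: "nat \<Rightarrow> real" where "Q k = (\<Prod>j=1..k. real (n j))"

lemma P_0 [simp]: "P 0 = 1" and Q_0 [simp]: "Q 0 = 1"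
  by (simp_all add: P_def Q_def)

lemma P_Suc: "P (Suc k) = P k * c (Suc k)" and Q_Suc: "Q (Suc k) = Q k * real (n (Suc k))"
  by (simp_all add: P_def Q_def)

lemma P_pos: "P k > 0"
  by (induction k) (simp_all add: P_Suc c_pos)

lemma Q_pos: "Q k > 0"
proof (induction k)
  case (Suc k)
  then show ?case using n_ge_2[of k] by (simp add: Q_Suc)
qed simp

lemma P_Suc_less: "P (Suc k) < P k"
  using P_pos c_less_1 by (simp add: P_Suc)

lemma P_antimono: "k \<le> l \<Longrightarrow> P l \<le> P k"
  by (rule lift_Suc_antimono_le) (simp_all add: P_Suc_less less_imp_le)

lemma P_ratio: "k \<le> l \<Longrightarrow> P l / P k = (\<Prod>j\<in>{k<..l}. c j)"
proof (induction l rule: dec_induct)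
  case base
  then show ?case using P_pos[of k] by simp
next
  case (step l)
  moreover have "{k<..Suc l} = insert (Suc l) {k<..l}" using step(1) by auto
  ultimately show ?case by (simp flip: step.IH add: P_Suc)
qed

lemma Q_ratio: "k \<le> l \<Longrightarrow> Q l / Q k = real (\<Prod>j\<in>{k<..l}. n j)"
proof (induction l rule: dec_induct)
  case base
  then show ?case using Q_pos[of k] by simp
next
  case (step l)
  moreover have "{k<..Suc l} = insert (Suc l) {k<..l}" using step(1) by auto
  ultimately show ?case by (simp flip: of_nat_prod step.IH add: Q_Suc)
qed

lemma Q_growth: "2 ^ m \<le> Q (k + m) / Q k"
proof (induction m)
  case (Suc m)
  have "2 ^ m * 2 \<le> (Q (k + m) / Q k) * real (n (Suc (k + m)))"
    using Suc n_ge_2[of "k + m"] Q_pos by (intro mult_mono) (auto simp: less_imp_le)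
  then show ?case by (simp add: Q_Suc mult.commute)
qed (use Q_pos[of k] in simp)

lemma words_nonempty: "D k \<noteq> {}"
proof (induction k)
  case (Suc k)
  then show ?case using n_ge_2[of k] by (auto simp: cantor_words_Suc)
qed simp

section \<open>Nesting, shape and size of basic sets\<close>

lemma J_subset_take:
  assumes "w \<in> D l" "k \<le> l"
  shows "J w \<subseteq> J (take k w)"
  using \<open>k \<le> l\<close> assms(1)
proof (induction l arbitrary: w rule: dec_induct)
  case base
  then show ?case by (simp add: length_cantor_words)
next
  case (step l)
  from step.prems obtain u j where uj: "w = u @ [j]" "u \<in> D l" "j \<in> {1..n (Suc l)}"
    by (rule cantor_words_SucE)
  then have "take k w = take k u"
    using step(1) by (simp add: length_cantor_words)
  then show ?case
    using step.IH[OF uj(2)] child_subset[OF uj(2,3)] uj(1) by auto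
qed

text \<open>Siblings are disjoint by hypothesis; for different parents, the disjointness of the
  parents' interiors passes down to the children.\<close>

lemma interior_disjoint:
  assumes "w \<in> D k" "w' \<in> D k" "w \<noteq> w'"
  shows "interior (J w) \<inter> interior (J w') = {}"
  using assms
proof (induction k arbitrary: w w')
  case 0
  then show ?case by simp
next
  case (Suc k)
  obtain u j where uj: "w = u @ [j]" "u \<in> D k" "j \<in> {1..n (Suc k)}"
    using Suc.prems(1) by (rule cantor_words_SucE)
  obtain u' j' where uj': "w' = u' @ [j']" "u' \<in> D k" "j' \<in> {1..n (Suc k)}"
    using Suc.prems(2) by (rule cantor_words_SucE)
  show ?case
  proof (cases "u = u'")
    case True
    then have "j \<noteq> j'" using Suc.prems(3) uj uj' by simp
    then show ?thesis
      using children_disjoint[OF uj(2)] uj uj' True by (auto simp: disjoint_family_on_def)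
  next
    case False
    have "interior (J w) \<subseteq> interior (J u)" "interior (J w') \<subseteq> interior (J u')"
      using child_subset uj uj' by (auto intro!: interior_mono)
    then show ?thesis
      using Suc.IH[OF uj(2) uj'(2) False] by blast
  qed
qed

text \<open>Similarities preserve the proportion of an inscribed ball to the diameter, so the
  constant found at the root serves for all basic sets.\<close>

lemma basic_set_geometry:
  "\<exists>\<kappa>>0. \<forall>k. \<forall>w\<in>D k.
     compact (J w) \<and> 0 < diameter (J w) \<and> (\<exists>z. ball z (\<kappa> * diameter (J w)) \<subseteq> J w)"
proof -
  obtain z e where e: "e > 0" "ball z e \<subseteq> J []"
    using interior_root by (auto simp: mem_interior)
  have bd: "bounded (J [])"
    using compact_root by (rule compact_imp_bounded)
  \<comment> \<open>The inner ball of the root shows that its diameter, the denominator of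
    \<open>\<kappa>\<close>, is positive.\<close>
  have "0 < 2 * e" using e by simp
  also have "\<dots> = diameter (ball z e)"
    using e by (simp add: diameter_ball)
  also have "\<dots> \<le> diameter (J [])"
    using e bd by (intro diameter_subset)
  finally have d0: "diameter (J []) > 0" .
  define \<kappa> where "\<kappa> = e / diameter (J [])"
  have "compact (J w) \<and> 0 < diameter (J w) \<and> (\<exists>z. ball z (\<kappa> * diameter (J w)) \<subseteq> J w)"
    if "w \<in> D k" for k w
    using that
  proof (induction k arbitrary: w)
    case 0
    then show ?case
      using e d0 compact_root by (auto simp: \<kappa>_def)
  next
    case (Suc k)
    from Suc.prems obtain u j where uj: "w = u @ [j]" "u \<in> D k" "j \<in> {1..n (Suc k)}"
      by (rule cantor_words_SucE)
    obtain z where u: "compact (J u)" "0 < diameter (J u)" "ball z (\<kappa> * diameter (J u)) \<subseteq> J u"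
      using Suc.IH[OF uj(2)] by blast
    obtain \<rho> f where f: "similarity \<rho> f" "J w = f ` J u"
      using child_similar[OF uj(2,3)] uj(1) by (auto simp: geometrically_similar_def)
    have "J u \<noteq> {}" using u(2) by auto
    then have diam: "diameter (J w) = \<rho> * diameter (J u)"
      using similarity_diameter f u(1) by metis
    have "ball (f z) (\<kappa> * diameter (J w)) \<subseteq> J w"
      using similarity_ball[OF f(1), of z "\<kappa> * diameter (J u)"] u(3)
      unfolding f(2)[symmetric] diam by (auto simp: f(2) mult_ac)
    moreover have "0 < diameter (J w)"
      using diam u(2) f(1) by (simp add: similarity_def)
    ultimately show ?case
      using similarity_compact[OF f(1) u(1)] f(2) by auto
  qed
  moreover have "\<kappa> > 0"
    using e d0 by (simp add: \<kappa>_def)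
  ultimately show ?thesis by blast
qed

lemma compact_J: "w \<in> D k \<Longrightarrow> compact (J w)"
  using basic_set_geometry by blast

lemma diameter_J_pos: "w \<in> D k \<Longrightarrow> 0 < diameter (J w)"
  using basic_set_geometry by blast

lemma J_nonempty: "w \<in> D k \<Longrightarrow> J w \<noteq> {}"
  using diameter_J_pos by fastforce

text \<open>Each factor \<open>1 + a k\<close> is at most \<open>exp (a k)\<close>, so their product
  stays below the exponential of the series.\<close>

lemma diameter_J_le:
  obtains C where "C \<ge> 1" "\<And>k w. w \<in> D k \<Longrightarrow> diameter (J w) \<le> C * P k"
proof -
  let ?A = "\<lambda>k. \<Sum>j<k. a (Suc j)"
  have le: "diameter (J w) \<le> diameter (J []) * exp (?A k) * P k" if "w \<in> D k" for k w
    using that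
  proof (induction k arbitrary: w)
    case 0
    then show ?case by simp
  next
    case (Suc k)
    from Suc.prems obtain u j where uj: "w = u @ [j]" "u \<in> D k" "j \<in> {1..n (Suc k)}"
      by (rule cantor_words_SucE)
    have "diameter (J w) \<le> c (Suc k) * (1 + a (Suc k)) * diameter (J u)"
      using child_diameter_le[OF uj(2,3)] diameter_J_pos[OF uj(2)] uj(1)
      by (simp add: pos_divide_le_eq)
    also have "\<dots> \<le> c (Suc k) * exp (a (Suc k)) * (diameter (J []) * exp (?A k) * P k)"
      using Suc.IH[OF uj(2)] diameter_J_pos[OF uj(2)] c_pos[of k] a_pos[of k]
      by (intro mult_mono mult_left_mono) auto
    also have "\<dots> = diameter (J []) * exp (?A (Suc k)) * P (Suc k)"
      by (simp add: exp_add P_Suc)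
    finally show ?case .
  qed
  define C where "C = max 1 (diameter (J []) * exp (suminf (\<lambda>k. a (Suc k))))"
  have "diameter (J w) \<le> C * P k" if "w \<in> D k" for k w
  proof -
    have "diameter (J w) \<le> diameter (J []) * exp (?A k) * P k"
      by (rule le[OF that])
    also have "\<dots> \<le> diameter (J []) * exp (suminf (\<lambda>k. a (Suc k))) * P k"
      using sum_le_suminf[OF a_summable, of "{..<k}"] a_pos P_pos[of k] diameter_J_pos[of "[]" 0]
      by (intro mult_right_mono mult_left_mono) (auto simp: less_imp_le)
    also have "\<dots> \<le> C * P k"
      using P_pos[of k] by (intro mult_right_mono) (auto simp: C_def)
    finally show ?thesis .
  qed
  then show thesis using that[of C] by (simp add: C_def)
qed

text \<open>The least normalised diameter of each level obeys the recursion of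
  \<open>positive_sequence_bounded_below\<close>.\<close>

lemma diameter_J_ge:
  obtains L where "L > 0" "\<And>k w. w \<in> D k \<Longrightarrow> L * P k \<le> diameter (J w)"
proof -
  define l where "l = (\<lambda>k. Min ((\<lambda>w. diameter (J w) / P k) ` D k))"
  have l_le: "l k \<le> diameter (J w) / P k" if "w \<in> D k" for k w
    unfolding l_def using that by (intro Min_le) auto
  have l_in: "l k \<in> (\<lambda>w. diameter (J w) / P k) ` D k" for k
    unfolding l_def using words_nonempty by (intro Min_in) auto
  have pos: "l k > 0" for k
    using l_in[of k] diameter_J_pos P_pos by auto
  have "(1 - a (Suc k)) * l k \<le> l (Suc k)" for k
  \<comment> \<open>For \<open>a (Suc k) > 1\<close> the lower ratio bound is negative, and
    positivity of \<open>l\<close> suffices.\<close>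
  proof (cases "a (Suc k) \<le> 1")
    case True
    obtain w where w: "w \<in> D (Suc k)" "l (Suc k) = diameter (J w) / P (Suc k)"
      using l_in[of "Suc k"] by auto
    obtain u j where uj: "w = u @ [j]" "u \<in> D k" "j \<in> {1..n (Suc k)}"
      using w(1) by (rule cantor_words_SucE)
    have "c (Suc k) * (1 - a (Suc k)) * (l k * P k) \<le> c (Suc k) * (1 - a (Suc k)) * diameter (J u)"
      using l_le[OF uj(2)] True c_pos[of k] P_pos[of k]
      by (intro mult_left_mono) (auto simp: pos_le_divide_eq)
    also have "\<dots> \<le> diameter (J w)"
      using child_diameter_ge[OF uj(2,3)] diameter_J_pos[OF uj(2)] uj(1)
      by (simp add: pos_le_divide_eq)
    finally show ?thesis
      using P_pos[of "Suc k"] by (simp add: w(2) pos_le_divide_eq P_Suc mult_ac)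
  next
    case False
    then have "(1 - a (Suc k)) * l k \<le> 0"
      using pos[of k] by (simp add: mult_le_0_iff)
    with pos[of "Suc k"] show ?thesis by linarith
  qed
  then obtain L where L: "L > 0" "\<And>k. L \<le> l k"
    using positive_sequence_bounded_below[of l "\<lambda>k. a (Suc k)", OF pos less_imp_le[OF a_pos] a_summable]
    by blast
  have "L * P k \<le> diameter (J w)" if "w \<in> D k" for k w
    using order_trans[OF L(2) l_le[OF that]] P_pos[of k] by (simp add: pos_le_divide_eq)
  with L(1) show thesis by (rule that)
qed

text \<open>The inscribed balls of the counted sets are disjoint and lie in a ball of radius
  \<open>T\<close> plus one diameter; compare volumes.\<close>

lemma card_meeting_ball:
  obtains M where "M > 0"
    "\<And>k x T. T \<ge> 0 \<Longrightarrow> real (card {w \<in> D k. J w \<inter> ball x T \<noteq> {}}) \<le> M * (T / P k + 1) ^ DIM('a)"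
proof -
  obtain \<kappa> where \<kappa>: "\<kappa> > 0" "\<And>k w. w \<in> D k \<Longrightarrow> \<exists>z. ball z (\<kappa> * diameter (J w)) \<subseteq> J w"
    using basic_set_geometry by blast
  obtain C where C: "C \<ge> 1" "\<And>k w. w \<in> D k \<Longrightarrow> diameter (J w) \<le> C * P k"
    using diameter_J_le by blast
  obtain L where L: "L > 0" "\<And>k w. w \<in> D k \<Longrightarrow> L * P k \<le> diameter (J w)"
    using diameter_J_ge by blast
  \<comment> \<open>\<open>s * P k\<close> is a common radius for balls inscribed at level
    \<open>k\<close>, as \<open>\<kappa> * diameter (J w) \<ge> \<kappa> * L * P k\<close>.\<close>
  define s where "s = \<kappa> * L"
  have "s > 0" using \<kappa> L by (simp add: s_def)
  have "real (card {w \<in> D k. J w \<inter> ball x T \<noteq> {}}) \<le> (C / s) ^ DIM('a) * (T / P k + 1) ^ DIM('a)"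
    if "T \<ge> 0" for k x T
  proof -
    let ?S = "{w \<in> D k. J w \<inter> ball x T \<noteq> {}}"
    have "\<exists>z. ball z (s * P k) \<subseteq> J w" if w: "w \<in> D k" for w
    proof -
      obtain z where "ball z (\<kappa> * diameter (J w)) \<subseteq> J w"
        using \<kappa>(2)[OF w] by blast
      moreover have "s * P k \<le> \<kappa> * diameter (J w)"
        using L(2)[OF w] \<kappa>(1) by (simp add: s_def)
      ultimately show ?thesis
        by (meson order_trans subset_ball)
    qed
    then obtain z where z: "\<And>w. w \<in> D k \<Longrightarrow> ball (z w) (s * P k) \<subseteq> J w"
      by metis
    have "real (card ?S) * (s * P k) ^ DIM('a) \<le> (T + C * P k) ^ DIM('a)"
    proof (rule card_disjoint_balls)
      show "disjoint_family_on (\<lambda>w. ball (z w) (s * P k)) ?S"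
      proof (unfold disjoint_family_on_def, intro ballI impI)
        fix w w' assume w: "w \<in> ?S" "w' \<in> ?S" "w \<noteq> w'"
        then have "ball (z w) (s * P k) \<subseteq> interior (J w)" "ball (z w') (s * P k) \<subseteq> interior (J w')"
          using z[of w] z[of w'] by (simp_all add: interior_maximal)
        then show "ball (z w) (s * P k) \<inter> ball (z w') (s * P k) = {}"
          using interior_disjoint[of w k w'] w by blast
      qed
      show "ball (z w) (s * P k) \<subseteq> ball x (T + C * P k)" if w: "w \<in> ?S" for w
      proof
        fix q assume "q \<in> ball (z w) (s * P k)"
        then have q: "q \<in> J w" using z[of w] w by blast
        obtain y where y: "y \<in> J w" "dist x y < T" using w by auto
        have "dist y q \<le> diameter (J w)"
          using w y q compact_J by (auto intro!: diameter_bounded_bound compact_imp_bounded)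
        then show "q \<in> ball x (T + C * P k)"
          using y(2) C(2)[of w k] w dist_triangle[of x q y] by simp
      qed
    qed (use \<open>s > 0\<close> P_pos[of k] that C(1) in auto)
    \<comment> \<open>Since \<open>C \<ge> 1\<close>, it can be pulled out of the sum, leaving a
      bound in \<open>T / P k\<close> alone.\<close>
    also have "\<dots> \<le> (C * (T + P k)) ^ DIM('a)"
      using that C(1) P_pos[of k] mult_right_mono[of 1 C T]
      by (intro power_mono) (auto simp: algebra_simps)
    also have "\<dots> = ((C / s) ^ DIM('a) * (T / P k + 1) ^ DIM('a)) * (s * P k) ^ DIM('a)"
      using \<open>s > 0\<close> P_pos[of k] by (simp add: field_simps flip: power_mult_distrib)
    finally show ?thesis
      using \<open>s > 0\<close> P_pos[of k] by (simp add: mult_le_cancel_right_pos)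
  qed
  then show thesis
    using that[of "(C / s) ^ DIM('a)"] \<open>s > 0\<close> C(1) by simp
qed

lemma card_extending: "w \<in> D k \<Longrightarrow> k \<le> l \<Longrightarrow> real (card {v \<in> D l. take k v = w}) = Q l / Q k"
  by (simp add: card_cantor_words_extending Q_ratio)

lemma J_subset_ball:
  assumes "w \<in> D k" "x \<in> J w" "diameter (J w) < T"
  shows "J w \<subseteq> ball x T"
proof
  fix y assume "y \<in> J w"
  then have "dist x y \<le> diameter (J w)"
    using assms by (intro diameter_bounded_bound compact_imp_bounded compact_J)
  with assms(3) show "y \<in> ball x T" by simp
qed

text \<open>The \<open>Q l / Q k\<close> descendants at level \<open>l\<close> of one set of level
  \<open>k\<close> all meet a ball of radius comparable to \<open>P k\<close>.\<close>

lemma Q_ratio_le: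
  obtains E where "E > 0" "\<And>k l. k \<le> l \<Longrightarrow> Q l / Q k \<le> E * (P k / P l) ^ DIM('a)"
proof -
  obtain C where C: "C \<ge> 1" "\<And>k w. w \<in> D k \<Longrightarrow> diameter (J w) \<le> C * P k"
    using diameter_J_le by blast
  obtain M where M: "M > 0"
    "\<And>k x T. T \<ge> 0 \<Longrightarrow> real (card {w \<in> D k. J w \<inter> ball x T \<noteq> {}}) \<le> M * (T / P k + 1) ^ DIM('a)"
    using card_meeting_ball by blast
  have "Q l / Q k \<le> M * (2 * C + 1) ^ DIM('a) * (P k / P l) ^ DIM('a)" if "k \<le> l" for k l
  proof -
    obtain w where w: "w \<in> D k" using words_nonempty by blast
    obtain x where x: "x \<in> J w" using J_nonempty[OF w] by blast
    \<comment> \<open>The factor 2 in the radius makes the diameter strictly smaller, as an open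
      ball requires.\<close>
    have "C * P k > 0" using C(1) P_pos[of k] by simp
    then have sub: "J w \<subseteq> ball x (2 * C * P k)"
      using C(2)[OF w] by (intro J_subset_ball[OF w x]) simp
    have "{v \<in> D l. take k v = w} \<subseteq> {v \<in> D l. J v \<inter> ball x (2 * C * P k) \<noteq> {}}"
      using J_subset_take[OF _ that] J_nonempty sub by blast
    then have "Q l / Q k \<le> real (card {v \<in> D l. J v \<inter> ball x (2 * C * P k) \<noteq> {}})"
      by (simp add: card_extending[OF w that, symmetric] card_mono)
    also have "\<dots> \<le> M * (2 * C * P k / P l + 1) ^ DIM('a)"
      using C(1) P_pos[of k] by (intro M(2)) simp
    also have "\<dots> \<le> M * ((2 * C + 1) * (P k / P l)) ^ DIM('a)"
    proof -
      \<comment> \<open>A ratio of at least 1 absorbs the summand 1.\<close>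
      have "1 \<le> P k / P l"
        using P_antimono[OF that] P_pos[of l] by simp
      then show ?thesis
        using M(1) C(1) P_pos[of k] P_pos[of l]
        by (intro mult_left_mono power_mono) (auto simp: distrib_right add_divide_distrib)
    qed
    finally show ?thesis by (simp only: power_mult_distrib mult.assoc)
  qed
  then show thesis
    using that[of "M * (2 * C + 1) ^ DIM('a)"] M(1) C(1) by simp
qed

section \<open>Points of K in the basic sets\<close>

lemma K_subset: "K \<subseteq> (\<Union>w\<in>D k. J w)"
proof (cases "k = 0")
  \<comment> \<open>Level 0 does not occur in the intersection defining \<open>K\<close>; it is
    reached through level 1.\<close>
  case True
  have "K \<subseteq> (\<Union>w\<in>D 1. J w)"
    unfolding K_def by (rule INF_lower) simp
  also have "\<dots> \<subseteq> J []"
    using J_subset_take[of _ 1 0] by auto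
  finally show ?thesis using True by simp
next
  case False
  then show ?thesis unfolding K_def by (intro INF_lower) simp
qed

text \<open>Always taking the first child gives nested nonempty compact sets, whose common point
  lies in \<open>K\<close>.\<close>

lemma J_meets_K:
  assumes "w \<in> D k"
  shows "J w \<inter> K \<noteq> {}"
proof -
  define ext where "ext = (\<lambda>m. w @ replicate m (1::nat))"
  have ext: "ext m \<in> D (k + m)" for m
  proof (induction m)
    case 0
    then show ?case using assms by (simp add: ext_def)
  next
    case (Suc m)
    then have "ext m @ [1] \<in> D (Suc (k + m))"
      using n_ge_2[of "k + m"] by (simp add: cantor_words_snoc_iff)
    then show ?case
      by (simp add: ext_def flip: replicate_append_same)
  qed
  have "\<Inter>(range (\<lambda>m. J (ext m))) \<noteq> {}"
  proof (rule compact_nest)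
    show "J (ext m') \<subseteq> J (ext m)" if "m \<le> m'" for m m'
    proof -
      have "take (k + m) (ext m') = ext m"
        using that length_cantor_words[OF assms] by (simp add: ext_def)
      then show ?thesis
        using J_subset_take[OF ext[of m'], of "k + m"] that by simp
    qed
  qed (use ext compact_J J_nonempty in blast)+
  then obtain x where x: "\<And>m. x \<in> J (ext m)" by blast
  have "x \<in> K"
    unfolding K_def
  \<comment> \<open>The prefix of length \<open>i\<close> of \<open>ext i\<close> has level
    \<open>i\<close>, whether \<open>i\<close> is below or above \<open>k\<close>.\<close>
  proof (intro INT_I UN_I)
    fix i :: nat
    show "take i (ext i) \<in> D i"
      using take_cantor_words[OF ext[of i]] by simp
    show "x \<in> J (take i (ext i))"
      using J_subset_take[OF ext[of i], of i] x by auto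
  qed
  moreover have "x \<in> J w"
    using x[of 0] by (simp add: ext_def)
  ultimately show ?thesis by blast
qed

section \<open>Logarithmic growth of counts and scales\<close>

definition u :: "nat \<Rightarrow> real" where "u k = ln (Q k)"

definition v :: "nat \<Rightarrow> real" where "v k = - ln (P k)"

lemma u_diff: "u l - u k = ln (Q l / Q k)"
  using Q_pos[of k] Q_pos[of l] by (simp add: u_def ln_div)

lemma v_diff: "v l - v k = ln (P k / P l)"
  using P_pos[of k] P_pos[of l] by (simp add: v_def ln_div)

lemma u_mono: "u k \<le> u (Suc k)"
proof -
  have "Q k * 1 \<le> Q k * real (n (Suc k))"
    using Q_pos[of k] n_ge_2[of k] by (intro mult_left_mono) auto
  then show ?thesis
    using Q_pos[of k] Q_pos[of "Suc k"] by (simp add: u_def Q_Suc)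
qed

lemma v_strict_mono: "v k < v (Suc k)"
  using P_pos[of k] P_pos[of "Suc k"] P_Suc_less[of k] by (simp add: v_def)

text \<open>The logarithm of \<open>Q_ratio_le\<close>; it bounds single steps of \<open>u\<close>
  from above and the growth of \<open>v\<close> from below.\<close>

lemma u_increment_le:
  obtains E where "\<And>k l. k \<le> l \<Longrightarrow> u l - u k \<le> real DIM('a) * (v l - v k) + E"
proof -
  obtain E where E: "E > 0" "\<And>k l. k \<le> l \<Longrightarrow> Q l / Q k \<le> E * (P k / P l) ^ DIM('a)"
    using Q_ratio_le by blast
  have "u l - u k \<le> real DIM('a) * (v l - v k) + ln E" if "k \<le> l" for k l
  proof -
    have pos: "Q l / Q k > 0" "P k / P l > 0"
      using Q_pos P_pos by auto
    then have "ln (Q l / Q k) \<le> ln (E * (P k / P l) ^ DIM('a))"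
      using E(1) E(2)[OF that] by (subst ln_le_cancel_iff) auto
    also have "\<dots> = ln E + real DIM('a) * ln (P k / P l)"
      using E(1) pos by (subst ln_mult) (auto simp: ln_realpow)
    finally show ?thesis
      by (simp add: u_diff v_diff)
  qed
  then show thesis by (rule that)
qed

text \<open>Ratios of at least \<open>\<gamma>\<close> leave room for boundedly many children only,
  by \<open>u_increment_le\<close> for consecutive levels.\<close>

lemma u_step_bounded:
  obtains X where "\<And>k. u (Suc k) - u k \<le> X"
proof -
  obtain E where E: "\<And>k l. k \<le> l \<Longrightarrow> u l - u k \<le> real DIM('a) * (v l - v k) + E"
    using u_increment_le by blast
  obtain \<gamma> where \<gamma>: "\<gamma> > 0" "\<And>k. \<gamma> \<le> c (Suc k)"
    using c_bounded_below by blast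
  have "u (Suc k) - u k \<le> real DIM('a) * (- ln \<gamma>) + E" for k
  proof -
    have "v (Suc k) - v k = - ln (c (Suc k))"
      using P_pos[of k] c_pos[of k] by (simp add: v_def P_Suc ln_mult)
    also have "\<dots> \<le> - ln \<gamma>"
      using \<gamma>(1) \<gamma>(2)[of k] by simp
    finally have "real DIM('a) * (v (Suc k) - v k) \<le> real DIM('a) * (- ln \<gamma>)"
      by (intro mult_left_mono) auto
    with E[of k "Suc k"] show ?thesis by simp
  qed
  then show thesis by (rule that)
qed

text \<open>The number of basic sets at least doubles at each level, and by
  \<open>u_increment_le\<close> the scales must shrink accordingly.\<close>

lemma v_linear_growth:
  obtains \<delta> G where "\<delta> > 0" "\<And>k m. \<delta> * real m - G \<le> v (k + m) - v k"
proof -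
  obtain E where E: "\<And>k l. k \<le> l \<Longrightarrow> u l - u k \<le> real DIM('a) * (v l - v k) + E"
    using u_increment_le by blast
  have "ln 2 / DIM('a) * real m - E / DIM('a) \<le> v (k + m) - v k" for k m
  proof -
    have "real m * ln 2 = ln (2 ^ m)"
      by (simp add: ln_realpow)
    also have "\<dots> \<le> ln (Q (k + m) / Q k)"
      using Q_growth[of m k] by (intro ln_mono) auto
    also have "\<dots> \<le> real DIM('a) * (v (k + m) - v k) + E"
      using E[of k "k + m"] by (simp add: u_diff)
    finally have "(real m * ln 2 - E) / DIM('a) \<le> v (k + m) - v k"
      by (simp add: pos_divide_le_eq mult.commute)
    then show ?thesis
      by (simp add: diff_divide_distrib mult.commute)
  qed
  then show thesis
    using that[of "ln 2 / DIM('a)" "E / DIM('a)"] by simp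
qed

text \<open>Take the first level whose scale is at most \<open>R\<close>: the level before it
  exceeds \<open>R\<close>, and one step shrinks by at most \<open>\<gamma>\<close>. Minimality
  later orders the levels of two scales.\<close>

lemma level_of_scale:
  obtains \<gamma> where "\<gamma> > 0"
    "\<And>R. 0 < R \<Longrightarrow> R \<le> 1 \<Longrightarrow> \<exists>k. \<gamma> * R \<le> P k \<and> P k \<le> R \<and> (\<forall>i. P i \<le> R \<longrightarrow> k \<le> i)"
proof -
  obtain \<gamma> where \<gamma>: "\<gamma> > 0" "\<And>k. \<gamma> \<le> c (Suc k)"
    using c_bounded_below by blast
  obtain \<delta> G where \<delta>: "\<delta> > 0" "\<And>k m. \<delta> * real m - G \<le> v (k + m) - v k"
    using v_linear_growth by blast
  have "\<exists>k. \<gamma> * R \<le> P k \<and> P k \<le> R \<and> (\<forall>i. P i \<le> R \<longrightarrow> k \<le> i)" if R: "0 < R" "R \<le> 1" for R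
  proof -
    obtain m where "(G - ln R) / \<delta> < real m"
      using reals_Archimedean2 by blast
    then have "- ln R \<le> \<delta> * real m - G"
      using \<delta>(1) by (simp add: pos_divide_less_eq mult.commute)
    then have "ln (P m) \<le> ln R"
      using \<delta>(2)[of m 0] by (simp add: v_def)
    then have m: "P m \<le> R"
      using R P_pos[of m] by simp
    define k where "k = (LEAST i. P i \<le> R)"
    have k: "P k \<le> R" "\<And>i. P i \<le> R \<Longrightarrow> k \<le> i"
      unfolding k_def using m by (auto intro: LeastI Least_le)
    have "\<gamma> * R \<le> P k"
    proof (cases k)
      \<comment> \<open>The root has no previous level; here \<open>R \<le> 1\<close> and
        \<open>\<gamma> < 1\<close> give the bound.\<close>
      case 0
      have "\<gamma> * R \<le> 1 * 1"
        using \<gamma>(1) \<gamma>(2)[of 0] c_less_1[of 0] R by (intro mult_mono) auto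
      with 0 show ?thesis by simp
    next
      case (Suc i)
      then have "R \<le> P i" using k(2)[of i] by force
      then have "R * \<gamma> \<le> P i * c (Suc i)"
        using R \<gamma>(1) \<gamma>(2)[of i] P_pos[of i] by (intro mult_mono) auto
      with Suc show ?thesis by (simp add: P_Suc mult.commute)
    qed
    with k show ?thesis by blast
  qed
  with \<gamma>(1) show thesis by (rule that)
qed

section \<open>Admissible exponents of K\<close>

definition assouad_exponent :: "real \<Rightarrow> bool" where
  "assouad_exponent \<alpha> \<longleftrightarrow> (\<exists>b C. 0 < b \<and> 0 < C \<and>
     (\<forall>r R. 0 < r \<and> r < R \<and> R < b \<longrightarrow>
        ereal_of_enat (covering_number r R K) \<le> ereal (C * (R / r) powr \<alpha>)))"

text \<open>Replace \<open>R\<close> and \<open>r\<close> by levels \<open>k\<close> and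
  \<open>l\<close>. Boundedly many sets of level \<open>k\<close> meet the ball, each has
  \<open>Q l / Q k\<close> descendants of diameter below \<open>r\<close>, and a point of
  \<open>K\<close> in each descendant serves as centre.\<close>

lemma assouad_exponent_if_dominated:
  assumes dom: "dominated_increments u v \<alpha>" and "\<alpha> \<ge> 0"
  shows "assouad_exponent \<alpha>"
proof -
  obtain E where E: "\<And>k l. k \<le> l \<Longrightarrow> u l - u k \<le> \<alpha> * (v l - v k) + E"
    using dom by (auto simp: dominated_increments_def)
  obtain C where C: "C \<ge> 1" "\<And>k w. w \<in> D k \<Longrightarrow> diameter (J w) \<le> C * P k"
    using diameter_J_le by blast
  obtain M where M: "M > 0"
    "\<And>k x T. T \<ge> 0 \<Longrightarrow> real (card {w \<in> D k. J w \<inter> ball x T \<noteq> {}}) \<le> M * (T / P k + 1) ^ DIM('a)"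
    using card_meeting_ball by blast
  obtain \<gamma> where \<gamma>: "\<gamma> > 0"
    "\<And>R. 0 < R \<Longrightarrow> R \<le> 1 \<Longrightarrow> \<exists>k. \<gamma> * R \<le> P k \<and> P k \<le> R \<and> (\<forall>i. P i \<le> R \<longrightarrow> k \<le> i)"
    using level_of_scale by blast
  \<comment> \<open>Bounds the number of level \<open>k\<close> sets meeting a ball of radius
    \<open>R\<close>, since \<open>R / P k \<le> 1 / \<gamma>\<close>.\<close>
  define M1 where "M1 = M * (1 / \<gamma> + 1) ^ DIM('a)"
  have "M1 > 0" using M(1) \<gamma>(1) by (simp add: M1_def add_pos_pos)
  \<comment> \<open>\<open>exp E\<close> comes from the slack, \<open>2 * C / \<gamma>\<close> from
    comparing \<open>P k / P l\<close> with \<open>R / r\<close>.\<close>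
  define B where "B = M1 * (exp E * (2 * C / \<gamma>) powr \<alpha>)"
  have "B > 0" using \<open>M1 > 0\<close> C(1) \<gamma>(1) by (simp add: B_def)
  have "ereal_of_enat (covering_number r R K) \<le> ereal (B * (R / r) powr \<alpha>)"
    if rR: "0 < r" "r < R" "R < 1" for r R
  proof (rule covering_number_le)
    show "0 \<le> B * (R / r) powr \<alpha>" using \<open>B > 0\<close> by simp
    fix x assume "x \<in> K"
    obtain k where k: "\<gamma> * R \<le> P k" "P k \<le> R" "\<And>i. P i \<le> R \<Longrightarrow> k \<le> i"
      using \<gamma>(2)[of R] rR by auto
    \<comment> \<open>Level \<open>l\<close> belongs to the scale \<open>r / (2 * C)\<close>, so
      that its diameters, at most \<open>C * P l\<close>, stay below \<open>r\<close>.\<close>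
    have r': "0 < r / (2 * C)" "r / (2 * C) \<le> r"
      using rR C(1) by (auto simp: pos_divide_le_eq)
    then obtain l where l: "\<gamma> * (r / (2 * C)) \<le> P l" "P l \<le> r / (2 * C)"
      using \<gamma>(2)[of "r / (2 * C)"] rR by auto
    have "k \<le> l" using k(3)[of l] l r' rR by linarith
    have small: "diameter (J w) < r" if "w \<in> D l" for w
    proof -
      have "diameter (J w) \<le> C * P l" by (rule C(2)[OF that])
      also have "\<dots> \<le> C * (r / (2 * C))" using l(2) C(1) by (intro mult_left_mono) auto
      also have "\<dots> < r" using C(1) rR by simp
      finally show ?thesis .
    qed
    let ?W = "\<lambda>i. {w \<in> D i. J w \<inter> ball x R \<noteq> {}}"
    have "real (card (?W k)) \<le> M * (R / P k + 1) ^ DIM('a)"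
      using rR by (intro M(2)) simp
    also have "\<dots> \<le> M1"
      unfolding M1_def using M(1) k(1) \<gamma>(1) P_pos[of k] rR
      by (intro mult_left_mono power_mono add_right_mono) (auto simp: field_simps)
    finally have Wk: "real (card (?W k)) \<le> M1" .
    \<comment> \<open>Truncating a word enlarges its set, so prefixes of words meeting the ball meet
      it too.\<close>
    have sub: "?W l \<subseteq> (\<Union>w\<in>?W k. {w' \<in> D l. take k w' = w})"
      using J_subset_take[OF _ \<open>k \<le> l\<close>] take_cantor_words[OF _ \<open>k \<le> l\<close>] by blast
    have "card (?W l) \<le> card (\<Union>w\<in>?W k. {w' \<in> D l. take k w' = w})"
      using sub by (intro card_mono) auto
    also have "\<dots> \<le> (\<Sum>w\<in>?W k. card {w' \<in> D l. take k w' = w})"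
      by (intro card_UN_le) auto
    finally have "real (card (?W l)) \<le> (\<Sum>w\<in>?W k. real (card {w' \<in> D l. take k w' = w}))"
      by (simp flip: of_nat_sum)
    also have "\<dots> = real (card (?W k)) * (Q l / Q k)"
      using \<open>k \<le> l\<close> by (simp add: card_extending)
    also have "\<dots> \<le> M1 * (exp E * (2 * C / \<gamma>) powr \<alpha> * (R / r) powr \<alpha>)"
    proof (rule mult_mono[OF Wk])
      have "Q l / Q k = exp (u l - u k)"
        using Q_pos by (simp add: u_diff)
      also have "\<dots> \<le> exp (\<alpha> * (v l - v k) + E)"
        using E[OF \<open>k \<le> l\<close>] by simp
      also have "\<dots> = exp E * (P k / P l) powr \<alpha>"
        using P_pos[of k] P_pos[of l] by (simp add: v_diff powr_def exp_add mult.commute)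
      also have "\<dots> \<le> exp E * (2 * C / \<gamma> * (R / r)) powr \<alpha>"
      proof -
        have "P k / P l \<le> R / (\<gamma> * (r / (2 * C)))"
          using k(2) l(1) P_pos[of k] r'(1) \<gamma>(1) rR
          by (intro frac_le mult_pos_pos) (auto simp: less_imp_le)
        also have "\<dots> = 2 * C / \<gamma> * (R / r)"
          using C(1) by (simp add: field_simps)
        finally show ?thesis
          using \<open>\<alpha> \<ge> 0\<close> P_pos[of k] P_pos[of l]
          by (intro mult_left_mono powr_mono2) (auto simp: less_imp_le)
      qed
      also have "\<dots> = exp E * (2 * C / \<gamma>) powr \<alpha> * (R / r) powr \<alpha>"
        using C(1) \<gamma>(1) rR by (simp only: powr_mult mult.assoc)
      finally show "Q l / Q k \<le> exp E * (2 * C / \<gamma>) powr \<alpha> * (R / r) powr \<alpha>" .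
    qed (use \<open>M1 > 0\<close> Q_pos in \<open>auto simp: less_imp_le\<close>)
    finally have Wl: "real (card (?W l)) \<le> B * (R / r) powr \<alpha>"
      by (simp add: B_def mult_ac)
    have "\<forall>w\<in>D l. \<exists>q. q \<in> J w \<inter> K"
      using J_meets_K by blast
    then obtain p where p: "\<And>w. w \<in> D l \<Longrightarrow> p w \<in> J w \<inter> K"
      by (metis bchoice)
    show "\<exists>S\<subseteq>K. finite S \<and> real (card S) \<le> B * (R / r) powr \<alpha> \<and>
            K \<inter> ball x R \<subseteq> (\<Union>y\<in>S. K \<inter> ball y r)"
    proof (intro exI conjI)
      show "p ` ?W l \<subseteq> K" using p by auto
      show "finite (p ` ?W l)" by simp
      have "card (p ` ?W l) \<le> card (?W l)"
        by (intro card_image_le) simp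
      with Wl show "real (card (p ` ?W l)) \<le> B * (R / r) powr \<alpha>" by linarith
      show "K \<inter> ball x R \<subseteq> (\<Union>y\<in>p ` ?W l. K \<inter> ball y r)"
      proof
        fix y assume y: "y \<in> K \<inter> ball x R"
        then obtain w where w: "w \<in> D l" "y \<in> J w"
          using K_subset[of l] by blast
        have "y \<in> ball (p w) r"
          using J_subset_ball[OF w(1) _ small[OF w(1)], of "p w"] p[OF w(1)] w(2) by blast
        moreover have "w \<in> ?W l" using w y by blast
        ultimately show "y \<in> (\<Union>y\<in>p ` ?W l. K \<inter> ball y r)" using y by blast
      qed
    qed
  qed
  then show ?thesis
    unfolding assouad_exponent_def using \<open>B > 0\<close> by (intro exI[of _ 1] exI[of _ B]) auto
qed

text \<open>Cover the part of \<open>K\<close> in a set of level \<open>k\<close> by balls of radius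
  \<open>P l\<close>. All \<open>Q l / Q k\<close> descendants contain points of \<open>K\<close>,
  while each covering ball meets boundedly many of them. The restriction \<open>R < b\<close>
  excludes only finitely many \<open>k\<close>.\<close>

lemma dominated_if_assouad_exponent:
  assumes exponent: "assouad_exponent \<alpha>" and "\<alpha> \<ge> 0"
  shows "dominated_increments u v \<alpha>"
proof -
  obtain b B where b: "b > 0" "B > 0" and cov: "\<And>r R. 0 < r \<Longrightarrow> r < R \<Longrightarrow> R < b \<Longrightarrow>
      ereal_of_enat (covering_number r R K) \<le> ereal (B * (R / r) powr \<alpha>)"
    using exponent by (auto simp: assouad_exponent_def)
  obtain C where C: "C \<ge> 1" "\<And>k w. w \<in> D k \<Longrightarrow> diameter (J w) \<le> C * P k"
    using diameter_J_le by blast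
  obtain M where M: "M > 0"
    "\<And>k x T. T \<ge> 0 \<Longrightarrow> real (card {w \<in> D k. J w \<inter> ball x T \<noteq> {}}) \<le> M * (T / P k + 1) ^ DIM('a)"
    using card_meeting_ball by blast
  \<comment> \<open>The bound of \<open>M\<close> for radius \<open>P l\<close> at level
    \<open>l\<close>, where \<open>T / P l + 1 = 2\<close>.\<close>
  define M1 where "M1 = M * 2 ^ DIM('a)"
  have "M1 > 0" using M(1) by (simp add: M1_def)
  \<comment> \<open>The factor \<open>(2 * C) powr \<alpha>\<close> comes from the radius
    \<open>R = 2 * C * P k\<close>.\<close>
  define F where "F = B * (2 * C) powr \<alpha> * M1"
  have "F > 0" using b \<open>M1 > 0\<close> C(1) by (simp add: F_def)
  \<comment> \<open>From \<open>k0\<close> on, the radius \<open>2 * C * P k\<close> is at most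
    \<open>b / 2\<close>; the 1 keeps the scale within the range of
    \<open>level_of_scale\<close>.\<close>
  have "0 < min 1 (b / (4 * C))" using b C(1) by simp
  then obtain k0 where k0: "P k0 \<le> min 1 (b / (4 * C))"
    using level_of_scale by (metis min.cobounded1)
  have small: "u l - u k \<le> \<alpha> * (v l - v k) + ln F" if "k0 \<le> k" "k \<le> l" for k l
  proof -
    define R where "R = 2 * C * P k"
    have "P k \<le> b / (4 * C)" using k0 P_antimono[OF that(1)] by simp
    then have "R \<le> b / 2" using C(1) by (simp add: R_def field_simps)
    then have "R < b" using b by simp
    have "1 * P k < 2 * C * P k" using C(1) P_pos[of k] by (intro mult_strict_right_mono) auto
    then have "P l < R" using P_antimono[OF that(2)] by (simp add: R_def)
    obtain w where w: "w \<in> D k" using words_nonempty by blast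
    obtain x where x: "x \<in> J w" "x \<in> K" using J_meets_K[OF w] by blast
    have "C * P k > 0" using C(1) P_pos[of k] by simp
    then have sub: "J w \<subseteq> ball x R"
      using C(2)[OF w] by (intro J_subset_ball[OF w x(1)]) (simp add: R_def)
    obtain S where S: "S \<subseteq> K" "finite S" "real (card S) \<le> B * (R / P l) powr \<alpha>"
      "K \<inter> ball x R \<subseteq> (\<Union>y\<in>S. K \<inter> ball y (P l))"
      using covering_number_leD[OF cov[OF P_pos \<open>P l < R\<close> \<open>R < b\<close>] x(2)] by blast
    let ?V = "{w' \<in> D l. take k w' = w}" and ?W = "\<lambda>y. {w' \<in> D l. J w' \<inter> ball y (P l) \<noteq> {}}"
    have "?V \<subseteq> (\<Union>y\<in>S. ?W y)"
    proof
      fix w' assume w': "w' \<in> ?V"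
      then obtain p where p: "p \<in> J w'" "p \<in> K" using J_meets_K by blast
      moreover have "p \<in> ball x R"
        using p(1) w' J_subset_take[OF _ that(2)] sub by blast
      ultimately show "w' \<in> (\<Union>y\<in>S. ?W y)"
        using S(4) w' by blast
    qed
    then have "card ?V \<le> card (\<Union>y\<in>S. ?W y)"
      using S(2) by (intro card_mono) auto
    also have "\<dots> \<le> (\<Sum>y\<in>S. card (?W y))"
      using S(2) by (rule card_UN_le)
    finally have "Q l / Q k \<le> (\<Sum>y\<in>S. real (card (?W y)))"
      by (simp add: card_extending[OF w that(2), symmetric] flip: of_nat_sum)
    also have "\<dots> \<le> (\<Sum>y\<in>S. M1)"
      using M(2)[of "P l" l] P_pos[of l] by (intro sum_mono) (simp add: M1_def)
    also have "\<dots> = real (card S) * M1"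
      by simp
    also have "\<dots> \<le> B * (R / P l) powr \<alpha> * M1"
      using S(3) \<open>M1 > 0\<close> by (intro mult_right_mono) auto
    also have "\<dots> = F * (P k / P l) powr \<alpha>"
      using C(1) P_pos[of k] P_pos[of l] by (simp add: R_def F_def powr_mult powr_divide)
    finally have le: "Q l / Q k \<le> F * (P k / P l) powr \<alpha>" .
    have pos: "Q l / Q k > 0" "P k / P l > 0"
      using Q_pos P_pos by auto
    have "ln (Q l / Q k) \<le> ln (F * (P k / P l) powr \<alpha>)"
      using le pos(1) by (intro ln_mono)
    also have "\<dots> = ln F + \<alpha> * ln (P k / P l)"
      using \<open>F > 0\<close> pos P_pos[of k] P_pos[of l] by (subst ln_mult) (auto simp: ln_powr)
    finally show ?thesis by (simp add: u_diff v_diff)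
  qed
  have mono: "mono u" "mono v"
    using u_mono v_strict_mono by (auto simp: mono_iff_le_Suc less_imp_le)
  \<comment> \<open>Levels below \<open>k0\<close> contribute at most \<open>u k0\<close>, as
    \<open>u 0 = 0\<close>; the absolute value covers a negative \<open>ln F\<close>.\<close>
  have "u l - u k \<le> \<alpha> * (v l - v k) + (\<bar>ln F\<bar> + u k0)" if "k \<le> l" for k l
  proof -
    have "u 0 = 0" by (simp add: u_def)
    then have u_nonneg: "u i \<ge> 0" for i
      using monoD[OF mono(1), of 0 i] by simp
    have v_nonneg: "0 \<le> \<alpha> * (v l - v k)"
      using \<open>\<alpha> \<ge> 0\<close> monoD[OF mono(2) that] by simp
    consider "k0 \<le> k" | "k \<le> k0" "k0 \<le> l" | "l \<le> k0" by linarith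
    then show ?thesis
    proof cases
      case 1
      then show ?thesis
        using small[OF 1 that] u_nonneg[of k0] by linarith
    next
      case 2
      have "\<alpha> * (v l - v k0) \<le> \<alpha> * (v l - v k)"
        using \<open>\<alpha> \<ge> 0\<close> monoD[OF mono(2) 2(1)] by (intro mult_left_mono) auto
      then show ?thesis
        using small[OF order_refl 2(2)] u_nonneg[of k] by linarith
    next
      case 3
      then show ?thesis
        using monoD[OF mono(1) 3] u_nonneg[of k] v_nonneg by linarith
    qed
  qed
  then show ?thesis
    unfolding dominated_increments_def by blast
qed

section \<open>The dimension and the limit formula\<close>

lemma assouad_dim_K:
  "assouad_dim K = (INF \<alpha> \<in> {\<alpha>. 0 \<le> \<alpha> \<and> dominated_increments u v \<alpha>}. ereal \<alpha>)"
proof -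
  have "{\<alpha>. 0 \<le> \<alpha> \<and> assouad_exponent \<alpha>} = {\<alpha>. 0 \<le> \<alpha> \<and> dominated_increments u v \<alpha>}"
    using assouad_exponent_if_dominated dominated_if_assouad_exponent by blast
  then show ?thesis
    unfolding assouad_dim_def assouad_exponent_def by simp
qed

text \<open>The block \<open>k..k+m\<close> has \<open>m + 1\<close> factors and starts after level
  \<open>k - 1\<close>; shifting \<open>k\<close> by one turns its products into increments of
  \<open>u\<close> and \<open>v\<close>.\<close>

lemma block_slopes_eq:
  "(SUP k\<in>{1..}. ereal (ln (real (\<Prod>j=k..k+m. n j)) / - ln (\<Prod>j=k..k+m. c j)))
     = (SUP k. ereal ((u (k + Suc m) - u k) / (v (k + Suc m) - v k)))"
proof -
  have "ln (real (\<Prod>j=Suc k..Suc k+m. n j)) / - ln (\<Prod>j=Suc k..Suc k+m. c j)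
      = (u (k + Suc m) - u k) / (v (k + Suc m) - v k)" for k
  proof -
    have set: "{Suc k..Suc k + m} = {k<..k + Suc m}" by auto
    have "v (k + Suc m) - v k = - ln (P (k + Suc m) / P k)"
      using P_pos[of k] P_pos[of "k + Suc m"] by (simp add: v_def ln_div)
    also have "\<dots> = - ln (\<Prod>j=Suc k..Suc k+m. c j)"
      unfolding set by (simp only: P_ratio[of k "k + Suc m"] le_add1)
    moreover have "u (k + Suc m) - u k = ln (real (\<Prod>j=Suc k..Suc k+m. n j))"
      unfolding set u_diff by (simp only: Q_ratio[of k "k + Suc m"] le_add1)
    ultimately show ?thesis by (simp only:)
  qed
  moreover have "{1..} = range Suc"
    by (auto simp: image_iff Suc_le_eq gr0_conv_Suc)
  ultimately show ?thesis
    by (simp only: image_image)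
qed

lemma assouad_dim_limit:
  "(\<lambda>m. SUP k\<in>{1..}. ereal (ln (real (\<Prod>j=k..k+m. n j)) / - ln (\<Prod>j=k..k+m. c j)))
     \<longlonglongrightarrow> assouad_dim K"
proof -
  obtain X where "\<And>k. u (Suc k) - u k \<le> X"
    using u_step_bounded by blast
  moreover obtain \<delta> G where "\<delta> > 0" "\<And>k m. \<delta> * real m - G \<le> v (k + m) - v k"
    using v_linear_growth by blast
  ultimately show ?thesis
    unfolding block_slopes_eq assouad_dim_K
    using u_mono v_strict_mono by (intro block_slopes_tendsto)
qed

end

theorem theorem2:
  fixes I K :: "'a::euclidean_space set"
    and a c :: "nat \<Rightarrow> real"
    and n :: "nat \<Rightarrow> nat"
  assumes "\<And>k. k \<ge> 1 \<Longrightarrow> a k > 0"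
    and "summable (\<lambda>k. a (Suc k))"
    and "\<And>k. k \<ge> 1 \<Longrightarrow> 0 < c k \<and> c k < 1"
    and "\<And>k. k \<ge> 1 \<Longrightarrow> n k \<ge> 2"
    and "(INF k\<in>{1..}. c k) > 0"
    and "compact I"
    and "interior I \<noteq> {}"
    and "K \<in> cantor_like_sets I c n a"
  shows "(\<lambda>m. SUP k\<in>{1..}. ereal (ln (real (\<Prod>j=k..k+m. n j)) / - ln (\<Prod>j=k..k+m. c j)))
           \<longlonglongrightarrow> assouad_dim K"
proof -
  obtain J where J: "J [] = I"
    "\<And>k w. k \<ge> 1 \<Longrightarrow> w \<in> cantor_words n (k - 1) \<Longrightarrow>
       (\<forall>j\<in>{1..n k}.
          J (w @ [j]) \<subseteq> J w \<and>
          geometrically_similar (J (w @ [j])) (J w) \<and>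
          c k * (1 - a k) \<le> diameter (J (w @ [j])) / diameter (J w) \<and>
          diameter (J (w @ [j])) / diameter (J w) \<le> c k * (1 + a k)) \<and>
       disjoint_family_on (\<lambda>j. interior (J (w @ [j]))) {1..n k}"
    and K: "K = (\<Inter>k\<in>{1..}. \<Union>w\<in>cantor_words n k. J w)"
    using assms(8) unfolding cantor_like_sets_def by blast
  note child = J(2)[of "Suc k" for k, simplified]
  \<comment> \<open>A real infimum is a lower bound only when the set is bounded below; here 0
    bounds it.\<close>
  have "bdd_below (c ` {1..})"
    by (rule bdd_belowI2[of _ 0]) (use assms(3) in \<open>auto simp: less_imp_le\<close>)
  then have "(INF k\<in>{1..}. c k) \<le> c (Suc k)" for k
    by (intro cINF_lower) auto
  then have "\<exists>\<gamma>>0. \<forall>k. \<gamma> \<le> c (Suc k)"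
    using assms(5) by blast
  then interpret cantor_construction J c n a
    by unfold_locales (use assms J(1) child in auto)
  show ?thesis
    using assouad_dim_limit unfolding K K_def .
qed

end
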